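(* Let $\mu$ be a real number with $0<\mu<1$. Suppose $Q_\mu\subseteq X$ is a nonempty compact convex set which is $\mathcal{U}$-positively invariant and contained in $$C(\mu,U):=\Big\{x\in X:\ \sup_{u\in U}\lVert D_xG(u,x)\rVert\le\mu\Big\}.$$ Then for every input sequence $\mathbf{v}\in\mathcal{U}$ the system $x[k+1]=G(v[k+1],x[k])$ driven by $\mathbf{v}$ admits a unique entire solution in $Q_\mu$ (i.e. a unique entire solution $\{x[k]\}_{k\in\mathbb{Z}}$ with $x[k]\in Q_\mu$ for all $k\in\mathbb{Z}$). In particular, if this entire solution is contained in the interior of $Q_\mu$, then it is a uniformly attracting entire solution (UAES).
   Context: Standing assumptions: $U\subset\mathbb{R}^{N_i}$ is compact; $X\subset\mathbb{R}^{N_r}$ is compact (usually the compact closure of an $N_r$-dimensional Cartesian product of real intervals), with Euclidean distance $d_X$; $G:U\times X\to X$ is continuously differentiable in all arguments; for each $u\in U$ the map $G(u,\cdot):X\to X$ is a local diffeomorphism onto its image. $D_xG(u,x)$ is the Jacobian of $G$ in the state variable, and $\lVert\cdot\rVert$ is the matrix norm induced by the Euclidean norm. Input sequences: $\mathcal{U}=U^{\mathbb{Z}}$, with elements $\mathbf{u}=\{u[k]\}_{k\in\mathbb{Z}}$; the shift $\sigma:\mathcal{U}\to\mathcal{U}$ is $\sigma(\mathbf{u})=\{u[k+1]\}_{k\in\mathbb{Z}}$. The cocycle map $\Phi:\mathbb{Z}_{\ge 0}\times\mathcal{U}\times X\to X$ is $\Phi(0,\mathbf{u},x_0)=x_0$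 and $\Phi(n,\mathbf{u},x_0)=G(u[n],\Phi(n-1,\mathbf{u},x_0))$ for $n\ge1$; for $A\subseteq X$, $\Phi(n,\mathbf{u},A)$ is the image of $A$. A nonempty compact $B\subseteq X$ is $\mathcal{U}$-positively invariant if $\Phi(k,\mathbf{u},B)\subseteq B$ for all $\mathbf{u}\in\mathcal{U}$ and integers $k\ge0$. An entire solution for input $\mathbf{u}$ is a sequence $\{x[k]\}_{k\in\mathbb{Z}}$ in $X$ with $\Phi(s,\sigma^m(\mathbf{u}),x[m])=x[m+s]$ for all $m\in\mathbb{Z}$, $s\ge0$. A positively invariant nonautonomous set for input $\mathbf{u}$ is a family $\{B[k]\}_{k\in\mathbb{Z}}$ of nonempty compact subsets of $X$ with $\Phi(s,\sigma^m(\mathbf{u}),B[m])\subseteq B[m+s]$ for all $m\in\mathbb{Z}$, $s\ge0$. It is uniformly attracted to an entire solution $\{x[k]\}$ for $\mathbf{u}$ if $$\lim_{k\to\infty}\ \sup_{j\in\mathbb{Z}}\ h\big(\Phi(k,\sigma^j(\mathbf{u}),B[j]),x[j+k]\big)=0,$$ where $h(Y,Z)=\sup_{y\in Y}\inf_{z\in Z}d_X(y,z)$ is the Hausdorff semi-distance (a point is identified with its singleton). An entire solution $\{x[k]\}$ for $\mathbf{u}$ is a uniformly attracting entire solution (UAES) if there is a positively invariant nonautonomous set $\{B[k]\}$ of compact sets for $\mathbf{u}$, with $B[k]$ a neighbourhood of $x[k]$ for every $k$, that is uniformly attracted to $\{x[k]\}$. *)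

theory Defs
  imports "HOL-Analysis.Analysis"
begin

text \<open>
  Continuous differentiability on a set that need not be open: f' is a Frechet derivative of f
  relative to S and depends continuously (in operator norm) on the base point. Every map that is
  C1 on an open neighbourhood of S is C1 on S in this sense. Where S has isolated or degenerate
  points the derivative relative to S is not unique, hence f' is an explicit argument.
\<close>

definition C1_derivative_on ::
  "('a::real_normed_vector \<Rightarrow> 'b::real_normed_vector) \<Rightarrow> ('a \<Rightarrow> 'a \<Rightarrow>\<^sub>L 'b) \<Rightarrow> 'a set \<Rightarrow> bool" where
  "C1_derivative_on f f' S \<longleftrightarrow>
     (\<forall>p\<in>S. (f has_derivative blinfun_apply (f' p)) (at p within S)) \<and> continuous_on S f'"

definition diffeo_onto_image_on ::
  "('a::real_normed_vector \<Rightarrow> 'b::real_normed_vector) \<Rightarrow> 'a set \<Rightarrow> bool" where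
  "diffeo_onto_image_on f V \<longleftrightarrow>
     (\<exists>f'. C1_derivative_on f f' V) \<and>
     (\<exists>g g'. (\<forall>x\<in>V. g (f x) = x) \<and> C1_derivative_on g g' (f ` V))"

definition local_diffeo_onto_image_on ::
  "('a::real_normed_vector \<Rightarrow> 'b::real_normed_vector) \<Rightarrow> 'a set \<Rightarrow> bool" where
  "local_diffeo_onto_image_on f X \<longleftrightarrow>
     (\<forall>x\<in>X. \<exists>V. openin (top_of_set X) V \<and> x \<in> V \<and> diffeo_onto_image_on f V)"

text \<open>The Jacobian in the state variable, read off the total derivative DG of the
  map sending (u, x) to G u x.\<close>

definition state_jacobian ::
  "((real^'i) \<times> (real^'r) \<Rightarrow> ((real^'i) \<times> (real^'r)) \<Rightarrow>\<^sub>L (real^'r)) \<Rightarrow> real^'i \<Rightarrow> real^'r \<Rightarrow> real^'r^'r" where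
  "state_jacobian DG u x = matrix (\<lambda>h. blinfun_apply (DG (u, x)) (0, h))"

definition induced_norm :: "real^'n^'m \<Rightarrow> real" where
  "induced_norm A = onorm ((*v) A)"

definition contraction_region ::
  "((real^'i) \<times> (real^'r) \<Rightarrow> ((real^'i) \<times> (real^'r)) \<Rightarrow>\<^sub>L (real^'r)) \<Rightarrow> (real^'r) set \<Rightarrow> real \<Rightarrow> (real^'i) set
    \<Rightarrow> (real^'r) set" where
  "contraction_region DG X \<mu> U = {x \<in> X. (SUP u\<in>U. induced_norm (state_jacobian DG u x)) \<le> \<mu>}"

definition input_sequences :: "'u set \<Rightarrow> (int \<Rightarrow> 'u) set" where
  "input_sequences U = {u. \<forall>k. u k \<in> U}"

definition shift :: "(int \<Rightarrow> 'u) \<Rightarrow> int \<Rightarrow> 'u" where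
  "shift u = (\<lambda>k. u (k + 1))"

definition shift_power :: "int \<Rightarrow> (int \<Rightarrow> 'u) \<Rightarrow> int \<Rightarrow> 'u" where
  "shift_power m = (if 0 \<le> m then shift ^^ nat m else inv shift ^^ nat (- m))"

primrec cocycle :: "('u \<Rightarrow> 'x \<Rightarrow> 'x) \<Rightarrow> nat \<Rightarrow> (int \<Rightarrow> 'u) \<Rightarrow> 'x \<Rightarrow> 'x" where
  "cocycle G 0 u x = x"
| "cocycle G (Suc n) u x = G (u (int (Suc n))) (cocycle G n u x)"

definition positively_invariant ::
  "('u \<Rightarrow> 'x \<Rightarrow> 'x) \<Rightarrow> 'u set \<Rightarrow> ('x::metric_space) set \<Rightarrow> 'x set \<Rightarrow> bool" where
  "positively_invariant G U X B \<longleftrightarrow>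
     B \<noteq> {} \<and> compact B \<and> B \<subseteq> X \<and>
     (\<forall>u\<in>input_sequences U. \<forall>k. cocycle G k u ` B \<subseteq> B)"

definition entire_solution ::
  "('u \<Rightarrow> 'x \<Rightarrow> 'x) \<Rightarrow> 'x set \<Rightarrow> (int \<Rightarrow> 'u) \<Rightarrow> (int \<Rightarrow> 'x) \<Rightarrow> bool" where
  "entire_solution G X u x \<longleftrightarrow>
     (\<forall>k. x k \<in> X) \<and> (\<forall>m s. cocycle G s (shift_power m u) (x m) = x (m + int s))"

definition positively_invariant_nonautonomous ::
  "('u \<Rightarrow> 'x \<Rightarrow> 'x) \<Rightarrow> ('x::metric_space) set \<Rightarrow> (int \<Rightarrow> 'u) \<Rightarrow> (int \<Rightarrow> 'x set) \<Rightarrow> bool" where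
  "positively_invariant_nonautonomous G X u B \<longleftrightarrow>
     (\<forall>k. B k \<noteq> {} \<and> compact (B k) \<and> B k \<subseteq> X) \<and>
     (\<forall>m s. cocycle G s (shift_power m u) ` B m \<subseteq> B (m + int s))"

text \<open>Real-valued suprema and infima: they have their usual meaning for nonempty bounded
  arguments, in particular for nonempty subsets of a compact state space.\<close>

definition hausdorff_semidist :: "('x::metric_space) set \<Rightarrow> 'x set \<Rightarrow> real" where
  "hausdorff_semidist Y Z = (SUP y\<in>Y. INF z\<in>Z. dist y z)"

definition uniformly_attracted ::
  "('u \<Rightarrow> 'x \<Rightarrow> 'x) \<Rightarrow> (int \<Rightarrow> 'u) \<Rightarrow> (int \<Rightarrow> ('x::metric_space) set) \<Rightarrow> (int \<Rightarrow> 'x) \<Rightarrow> bool" where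
  "uniformly_attracted G u B x \<longleftrightarrow>
     (\<lambda>k. SUP j. hausdorff_semidist (cocycle G k (shift_power j u) ` B j) {x (j + int k)})
       \<longlonglongrightarrow> 0"

text \<open>Neighbourhoods are taken in the state space X, i.e. in its subspace topology.\<close>

definition UAES ::
  "('u \<Rightarrow> 'x \<Rightarrow> 'x) \<Rightarrow> ('x::metric_space) set \<Rightarrow> (int \<Rightarrow> 'u) \<Rightarrow> (int \<Rightarrow> 'x) \<Rightarrow> bool" where
  "UAES G X u x \<longleftrightarrow>
     entire_solution G X u x \<and>
     (\<exists>B. positively_invariant_nonautonomous G X u B \<and>
          (\<forall>k. x k \<in> top_of_set X interior_of B k) \<and>
          uniformly_attracted G u B x)"

lemma bij_shift: "bij (shift :: (int \<Rightarrow> 'u) \<Rightarrow> _)"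
  by (rule bij_betw_byWitness[where f' = "\<lambda>u k. u (k - 1)"]) (auto simp: shift_def)

lemma inv_shift: "inv shift u = (\<lambda>k. u (k - 1))"
  by (rule inv_f_eq[OF bij_is_inj[OF bij_shift]]) (simp add: shift_def)

lemma shift_power_apply: "shift_power m u k = u (k + m)"
proof -
  have pos: "(shift ^^ n) u k = u (k + int n)" for n k
    by (induction n arbitrary: k) (simp_all add: shift_def algebra_simps)
  have neg: "(inv shift ^^ n) u k = u (k - int n)" for n k
    by (induction n arbitrary: k) (simp_all add: inv_shift algebra_simps)
  show ?thesis
    by (simp add: shift_power_def pos neg)
qed

end

theory Submission
  imports Defs
begin

text \<open>
  On the convex set \<open>Q\<close> the Jacobian bound integrates along segments: every map \<open>G u\<close> with
  \<open>u \<in> U\<close> is \<open>\<mu>\<close>-Lipschitz on \<open>Q\<close> (lemma \<open>contraction_on_convex_subset\<close>), and it maps \<open>Q\<close> to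
  itself. So the system driven by \<open>v\<close> is a two-sided sequence of \<open>\<mu>\<close>-contractions
  \<open>F k = G (v k)\<close> of the compact set \<open>Q\<close>.

  The entire solutions in \<open>Q\<close> are precisely the fixed points of the operator
  \<open>(T x) k = F k (x (k - 1))\<close> on the space of all sequences \<open>x : \<int> \<rightarrow> Q\<close> with the supremum
  metric. This space is complete and \<open>T\<close> is a \<open>\<mu>\<close>-contraction of it, so Banach's theorem gives
  existence and uniqueness in one stroke (lemma \<open>ex1_bi_infinite_orbit\<close>); no pullback limit has to
  be constructed.

  For attraction take \<open>B k = Q\<close> for all \<open>k\<close>. After \<open>n\<close> steps every trajectory that starts in
  \<open>Q\<close> is within \<open>\<mu> ^ n * diameter Q\<close> of the solution, whatever the starting time, which is the uniformity that
  is demanded. The interior hypothesis says that \<open>Q\<close> is a neighbourhood of every point of the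
  solution.
\<close>

section \<open>Bi-infinite orbits of a sequence of contractions\<close>

text \<open>
  A Cauchy sequence for the supremum metric converges uniformly, so its limit is again bounded and
  continuous, and the values of the limit stay in the closed set. No metric on the domain enters, so
  the lemma applies to bi-infinite sequences, whose index set \<open>\<int>\<close> is a discrete space.
\<close>

lemma complete_bcontfun_into_closed:
  fixes Q :: "'b::complete_space set"
  assumes "closed Q"
  shows "complete {f :: 'a::topological_space \<Rightarrow>\<^sub>C 'b. \<forall>x. apply_bcontfun f x \<in> Q}"
  unfolding complete_def
proof (intro allI impI, elim conjE)
  fix g :: "nat \<Rightarrow> 'a \<Rightarrow>\<^sub>C 'b"
  assume g: "\<forall>n. g n \<in> {f. \<forall>x. apply_bcontfun f x \<in> Q}" and "Cauchy g"
  have "uniformly_Cauchy_on UNIV (\<lambda>n. apply_bcontfun (g n))"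
    unfolding uniformly_Cauchy_on_def
    using \<open>Cauchy g\<close> unfolding Cauchy_def by (meson dist_fun_lt_imp_dist_val_lt)
  then have "uniformly_convergent_on UNIV (\<lambda>n. apply_bcontfun (g n))"
    by (rule Cauchy_uniformly_convergent)
  then obtain l where l: "uniform_limit UNIV (\<lambda>n. apply_bcontfun (g n)) l sequentially"
    by (auto simp: uniformly_convergent_on_def)
  from uniform_limit_bcontfunE[OF l sequentially_bot]
  obtain l' where l': "l = apply_bcontfun l'" "g \<longlonglongrightarrow> l'" .
  have "l x \<in> Q" for x
    using closed_sequentially[OF assms, of "\<lambda>n. apply_bcontfun (g n) x" "l x"] g
      tendsto_uniform_limitI[OF l, of x] by simp
  then show "\<exists>l\<in>{f. \<forall>x. apply_bcontfun f x \<in> Q}. g \<longlonglongrightarrow> l"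
    using l' by auto
qed

text \<open>
  Compactness enters through completeness of \<open>Q\<close> and through boundedness, which makes the supremum
  metric finite. The index set carries the discrete topology, so the bounded continuous functions on
  it are all bounded sequences.
\<close>

lemma ex1_bi_infinite_orbit:
  fixes F :: "int \<Rightarrow> 'a::complete_space \<Rightarrow> 'a" and Q :: "'a set"
  assumes Q: "compact Q" "Q \<noteq> {}" and c: "0 \<le> c" "c < 1"
    and maps: "\<And>k x. x \<in> Q \<Longrightarrow> F k x \<in> Q"
    and contr: "\<And>k x y. x \<in> Q \<Longrightarrow> y \<in> Q \<Longrightarrow> dist (F k x) (F k y) \<le> c * dist x y"
  shows "\<exists>!x. (\<forall>k. x k \<in> Q) \<and> (\<forall>k. x (k + 1) = F (k + 1) (x k))"
proof -
  have bcont: "x \<in> bcontfun" if "\<And>k. x k \<in> Q" for x :: "int \<Rightarrow> 'a"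
  proof -
    have "bounded (range x)"
      by (rule bounded_subset[OF compact_imp_bounded[OF Q(1)]]) (use that in auto)
    then show ?thesis
      by (simp add: bcontfun_def continuous_on_def tendsto_discrete at_discrete)
  qed
  define S :: "(int \<Rightarrow>\<^sub>C 'a) set" where "S = {f. \<forall>k. apply_bcontfun f k \<in> Q}"
  have S_iff: "f \<in> S \<longleftrightarrow> (\<forall>k. apply_bcontfun f k \<in> Q)" for f
    by (simp add: S_def)
  define T :: "(int \<Rightarrow>\<^sub>C 'a) \<Rightarrow> (int \<Rightarrow>\<^sub>C 'a)"
    where "T f = Bcontfun (\<lambda>k. F k (apply_bcontfun f (k - 1)))" for f
  have apply_T: "apply_bcontfun (T f) k = F k (apply_bcontfun f (k - 1))" if "f \<in> S" for f k
    unfolding T_def using that by (subst Bcontfun_inverse) (auto intro!: bcont maps simp: S_iff)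
  have "\<exists>!f\<in>S. T f = f"
  proof (rule Banach_fix)
    show "complete S"
      unfolding S_def by (intro complete_bcontfun_into_closed compact_imp_closed Q(1))
    obtain q where "q \<in> Q" using Q(2) by blast
    then have "const_bcontfun q \<in> S" by (simp add: S_iff)
    then show "S \<noteq> {}" by blast
    show "T ` S \<subseteq> S"
      by (auto simp: S_iff apply_T maps)
    show "dist (T f) (T g) \<le> c * dist f g" if "f \<in> S" "g \<in> S" for f g
    proof (rule dist_bound)
      fix k
      have "dist (T f k) (T g k) \<le> c * dist (f (k - 1)) (g (k - 1))"
        using that by (simp add: apply_T S_iff contr)
      also have "\<dots> \<le> c * dist f g"
        using c by (intro mult_left_mono dist_bounded)
      finally show "dist (T f k) (T g k) \<le> c * dist f g" .
    qed
  qed (use c in auto)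
  then obtain f where f: "f \<in> S" "T f = f" and uniq: "\<And>g. g \<in> S \<Longrightarrow> T g = g \<Longrightarrow> g = f"
    by blast
  show ?thesis
  proof (rule ex1I[where a = "apply_bcontfun f"])
    have "apply_bcontfun f (k + 1) = F (k + 1) (apply_bcontfun f k)" for k
      using apply_T[OF f(1), of "k + 1"] f(2) by simp
    then show "(\<forall>k. apply_bcontfun f k \<in> Q) \<and>
        (\<forall>k. apply_bcontfun f (k + 1) = F (k + 1) (apply_bcontfun f k))"
      using f(1) by (simp add: S_iff)
  next
    fix x assume x: "(\<forall>k. x k \<in> Q) \<and> (\<forall>k. x (k + 1) = F (k + 1) (x k))"
    then have ap: "apply_bcontfun (Bcontfun x) = x"
      by (intro Bcontfun_inverse bcont) auto
    then have inS: "Bcontfun x \<in> S"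
      using x by (simp add: S_iff)
    have "F k (x (k - 1)) = x k" for k
      using conjunct2[OF x, rule_format, of "k - 1"] by simp
    then have fix_T: "T (Bcontfun x) = Bcontfun x"
      by (intro bcontfun_eqI) (simp add: apply_T[OF inS] ap)
    show "x = apply_bcontfun f"
      using ap unfolding uniq[OF inS fix_T] by (rule sym)
  qed
qed

section \<open>From the Jacobian bound to a Lipschitz bound\<close>

lemma induced_norm_matrix:
  fixes f :: "real^'n \<Rightarrow> real^'m"
  assumes "linear f"
  shows "induced_norm (matrix f) = onorm f"
  unfolding induced_norm_def matrix_vector_mul(2)[OF assms] by (rule refl)

text \<open>
  A real-valued supremum bounds its members only when they are bounded above. Here this follows from
  compactness of \<open>U\<close> and continuity of the derivative, since the norm of a partial derivative is at
  most that of the total derivative.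
\<close>

lemma onorm_state_derivative_le_on_contraction_region:
  fixes U :: "(real^'i) set" and X :: "(real^'r) set"
  assumes U: "compact U" and cont: "continuous_on (U \<times> X) DG"
    and u: "u \<in> U" and x: "x \<in> contraction_region DG X \<mu> U"
  shows "onorm (\<lambda>h. blinfun_apply (DG (u, x)) (0, h)) \<le> \<mu>"
proof -
  have lin: "bounded_linear (\<lambda>h::real^'r. (0::real^'i, h))"
    by (intro bounded_linear_intros)
  have eq: "induced_norm (state_jacobian DG w x) = onorm (\<lambda>h. blinfun_apply (DG (w, x)) (0, h))" for w
    unfolding state_jacobian_def
    by (rule induced_norm_matrix[OF bounded_linear.linear[OF
          bounded_linear_compose[OF blinfun.bounded_linear_right lin]]])
  have le: "induced_norm (state_jacobian DG w x) \<le> norm (DG (w, x))" for w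
    unfolding eq
  proof (rule onorm_le)
    fix h :: "real^'r"
    show "norm (blinfun_apply (DG (w, x)) (0, h)) \<le> norm (DG (w, x)) * norm h"
      using norm_blinfun[of "DG (w, x)" "(0, h)"] by (simp add: norm_Pair)
  qed
  have "x \<in> X" and sup: "(SUP w\<in>U. induced_norm (state_jacobian DG w x)) \<le> \<mu>"
    using x by (auto simp: contraction_region_def)
  have "continuous_on U (\<lambda>w. DG (w, x))"
    by (rule continuous_on_compose2[OF cont]) (use \<open>x \<in> X\<close> in \<open>auto intro!: continuous_intros\<close>)
  then have "bounded ((\<lambda>w. DG (w, x)) ` U)"
    using U by (intro compact_imp_bounded compact_continuous_image)
  then obtain b where "\<And>w. w \<in> U \<Longrightarrow> norm (DG (w, x)) \<le> b"
    by (auto simp: bounded_iff)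
  then have "bdd_above ((\<lambda>w. induced_norm (state_jacobian DG w x)) ` U)"
    by (intro bdd_aboveI2[where M = b] order_trans[OF le])
  from order_trans[OF cSUP_upper[OF u this] sup] show ?thesis
    unfolding eq .
qed

lemma contraction_on_convex_subset:
  fixes U :: "(real^'i) set" and X :: "(real^'r) set" and G :: "real^'i \<Rightarrow> real^'r \<Rightarrow> real^'r"
  assumes U: "compact U" and C1: "C1_derivative_on (\<lambda>(u, x). G u x) DG (U \<times> X)"
    and Q: "convex Q" "Q \<subseteq> contraction_region DG X \<mu> U"
    and u: "u \<in> U" and xy: "x \<in> Q" "y \<in> Q"
  shows "dist (G u x) (G u y) \<le> \<mu> * dist x y"
  unfolding dist_norm
proof (rule differentiable_bound[OF Q(1) _ _ xy])
  fix z assume z: "z \<in> Q"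
  have QX: "Q \<subseteq> X" using Q(2) by (auto simp: contraction_region_def)
  have D: "((\<lambda>(u, x). G u x) has_derivative blinfun_apply (DG (u, z))) (at (u, z) within U \<times> X)"
    using C1 u z QX by (auto simp: C1_derivative_on_def)
  have "(((\<lambda>(u, x). G u x) \<circ> Pair u) has_derivative (blinfun_apply (DG (u, z)) \<circ> (\<lambda>h. (0, h))))
      (at z within Q)"
  proof (rule diff_chain_within)
    show "(Pair u has_derivative (\<lambda>h. (0, h))) (at z within Q)"
      by (intro has_derivative_Pair has_derivative_const has_derivative_ident)
    show "((\<lambda>(u, x). G u x) has_derivative blinfun_apply (DG (u, z))) (at (u, z) within Pair u ` Q)"
      by (rule has_derivative_subset[OF D]) (use u QX in auto)
  qed
  then show "(G u has_derivative (\<lambda>h. blinfun_apply (DG (u, z)) (0, h))) (at z within Q)"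
    by (simp add: o_def)
  show "onorm (\<lambda>h. blinfun_apply (DG (u, z)) (0, h)) \<le> \<mu>"
  proof (rule onorm_state_derivative_le_on_contraction_region[OF U _ u])
    show "continuous_on (U \<times> X) DG"
      using C1 by (simp add: C1_derivative_on_def)
    show "z \<in> contraction_region DG X \<mu> U"
      using z Q(2) by blast
  qed
qed

section \<open>Entire solutions and uniform attraction\<close>

lemma entire_solution_iff_one_step:
  "entire_solution G X v x \<longleftrightarrow> (\<forall>k. x k \<in> X) \<and> (\<forall>k. x (k + 1) = G (v (k + 1)) (x k))"
proof -
  have "cocycle G s (shift_power m v) (x m) = x (m + int s)"
    if step: "\<And>k. x (k + 1) = G (v (k + 1)) (x k)" for m s
  proof (induction s)
    case (Suc s)
    then show ?case
      using step[of "m + int s"] by (simp add: shift_power_apply algebra_simps)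
  qed simp
  moreover have "x (k + 1) = G (v (k + 1)) (x k)"
    if "\<And>m s. cocycle G s (shift_power m v) (x m) = x (m + int s)" for k
    using that[where m = k and s = 1] by (simp add: shift_power_apply add.commute)
  ultimately show ?thesis
    unfolding entire_solution_def by blast
qed

lemma shift_power_in_input_sequences:
  "v \<in> input_sequences U \<Longrightarrow> shift_power m v \<in> input_sequences U"
  by (simp add: input_sequences_def shift_power_apply)

lemma positively_invariant_maps_to:
  assumes "positively_invariant G U X Q" "u \<in> U" "x \<in> Q"
  shows "G u x \<in> Q"
proof -
  have "(\<lambda>_. u) \<in> input_sequences U"
    using assms(2) by (simp add: input_sequences_def)
  then have "cocycle G 1 (\<lambda>_. u) ` Q \<subseteq> Q"
    using assms(1) unfolding positively_invariant_def by blast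
  then show ?thesis
    using assms(3) by auto
qed

lemma cocycle_dist_le:
  assumes inv: "positively_invariant G U X Q" and "0 \<le> \<mu>"
    and contr: "\<And>u x y. u \<in> U \<Longrightarrow> x \<in> Q \<Longrightarrow> y \<in> Q \<Longrightarrow> dist (G u x) (G u y) \<le> \<mu> * dist x y"
    and w: "w \<in> input_sequences U" and xy: "x \<in> Q" "y \<in> Q"
  shows "dist (cocycle G n w x) (cocycle G n w y) \<le> \<mu> ^ n * dist x y"
proof (induction n)
  case (Suc n)
  have "cocycle G n w x \<in> Q" "cocycle G n w y \<in> Q"
    using inv w xy unfolding positively_invariant_def by blast+
  then have "dist (cocycle G (Suc n) w x) (cocycle G (Suc n) w y)
      \<le> \<mu> * dist (cocycle G n w x) (cocycle G n w y)"
    using w contr by (simp add: input_sequences_def)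
  also have "\<dots> \<le> \<mu> * (\<mu> ^ n * dist x y)"
    using Suc \<open>0 \<le> \<mu>\<close> by (rule mult_left_mono)
  finally show ?case by (simp add: mult.assoc)
qed simp

lemma hausdorff_semidist_singleton_bounds:
  assumes "Y \<noteq> {}" and le: "\<And>y. y \<in> Y \<Longrightarrow> dist y z \<le> b"
  shows "0 \<le> hausdorff_semidist Y {z}" "hausdorff_semidist Y {z} \<le> b"
proof -
  have eq: "hausdorff_semidist Y {z} = (SUP y\<in>Y. dist y z)"
    by (simp add: hausdorff_semidist_def)
  show "hausdorff_semidist Y {z} \<le> b"
    unfolding eq using assms by (rule cSUP_least)
  obtain y where "y \<in> Y" using \<open>Y \<noteq> {}\<close> by blast
  moreover have "bdd_above ((\<lambda>y. dist y z) ` Y)"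
    using le by (rule bdd_aboveI2)
  ultimately show "0 \<le> hausdorff_semidist Y {z}"
    unfolding eq by (meson cSUP_upper2 zero_le_dist)
qed

lemma uniformly_attracted_of_contraction:
  assumes inv: "positively_invariant G U X Q" and \<mu>: "0 \<le> \<mu>" "\<mu> < 1"
    and contr: "\<And>u x y. u \<in> U \<Longrightarrow> x \<in> Q \<Longrightarrow> y \<in> Q \<Longrightarrow> dist (G u x) (G u y) \<le> \<mu> * dist x y"
    and v: "v \<in> input_sequences U"
    and sol: "entire_solution G X v x" and xQ: "\<And>k. x k \<in> Q"
  shows "uniformly_attracted G v (\<lambda>_. Q) x"
  unfolding uniformly_attracted_def
proof (rule tendsto_sandwich[OF always_eventually always_eventually])
  define h where
    "h n j = hausdorff_semidist (cocycle G n (shift_power j v) ` Q) {x (j + int n)}" for n j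
  have "Q \<noteq> {}" and bdd: "bounded Q"
    using inv by (auto simp: positively_invariant_def compact_imp_bounded)
  \<comment> \<open>This bound does not depend on the starting time \<open>j\<close>, so it survives the supremum over \<open>j\<close>.\<close>
  have "dist y (x (j + int n)) \<le> \<mu> ^ n * diameter Q"
    if y: "y \<in> cocycle G n (shift_power j v) ` Q" for n j y
  proof -
    obtain q where q: "q \<in> Q" "y = cocycle G n (shift_power j v) q" using y by blast
    have "x (j + int n) = cocycle G n (shift_power j v) (x j)"
      using sol by (simp add: entire_solution_def)
    then have "dist y (x (j + int n)) \<le> \<mu> ^ n * dist q (x j)"
      using q xQ by (simp add: cocycle_dist_le[OF inv \<mu>(1) contr shift_power_in_input_sequences[OF v]])
    also have "\<dots> \<le> \<mu> ^ n * diameter Q"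
      using \<mu> bdd q xQ by (intro mult_left_mono diameter_bounded_bound) auto
    finally show ?thesis .
  qed
  then have h0: "0 \<le> h n j" and h1: "h n j \<le> \<mu> ^ n * diameter Q" for n j
    unfolding h_def using \<open>Q \<noteq> {}\<close> by (intro hausdorff_semidist_singleton_bounds; blast)+
  show "\<forall>n. (SUP j. hausdorff_semidist (cocycle G n (shift_power j v) ` Q) {x (j + int n)})
      \<le> \<mu> ^ n * diameter Q"
    using h1 unfolding h_def by (intro allI cSUP_least) auto
  have "bdd_above (range (h n))" for n
    using h1 by (rule bdd_aboveI2)
  then show "\<forall>n. 0 \<le> (SUP j. hausdorff_semidist (cocycle G n (shift_power j v) ` Q) {x (j + int n)})"
    unfolding h_def[symmetric] by (blast intro: cSUP_upper2 h0)
  show "(\<lambda>n. \<mu> ^ n * diameter Q) \<longlonglongrightarrow> 0"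
    using \<mu> by (intro tendsto_mult_left_zero LIMSEQ_power_zero) simp
qed simp

theorem theorem4p1:
  fixes U :: "(real^'i) set" and X :: "(real^'r) set"
    and G :: "real^'i \<Rightarrow> real^'r \<Rightarrow> real^'r"
    and DG :: "(real^'i) \<times> (real^'r) \<Rightarrow> ((real^'i) \<times> (real^'r)) \<Rightarrow>\<^sub>L (real^'r)"
    and \<mu> :: real and Q :: "(real^'r) set"
  assumes "compact U" and "compact X"
    and "\<And>u x. u \<in> U \<Longrightarrow> x \<in> X \<Longrightarrow> G u x \<in> X"
    and "C1_derivative_on (\<lambda>(u, x). G u x) DG (U \<times> X)"
    and "\<And>u. u \<in> U \<Longrightarrow> local_diffeo_onto_image_on (G u) X"
    and "0 < \<mu>" and "\<mu> < 1"
    and "Q \<noteq> {}" and "compact Q" and "convex Q" and "Q \<subseteq> X"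
    and "positively_invariant G U X Q"
    and "Q \<subseteq> contraction_region DG X \<mu> U"
  shows "\<forall>v\<in>input_sequences U.
           (\<exists>!x. entire_solution G X v x \<and> (\<forall>k. x k \<in> Q)) \<and>
           (\<forall>x. entire_solution G X v x \<and> (\<forall>k. x k \<in> Q) \<and>
                (\<forall>k. x k \<in> top_of_set X interior_of Q) \<longrightarrow> UAES G X v x)"
proof (intro ballI conjI allI impI)
  note inv = assms(12)
  note contr = contraction_on_convex_subset[OF \<open>compact U\<close> assms(4) \<open>convex Q\<close> assms(13)]
  fix v assume v: "v \<in> input_sequences U"
  then have vU: "v k \<in> U" for k
    by (simp add: input_sequences_def)
  have "\<exists>!x. (\<forall>k. x k \<in> Q) \<and> (\<forall>k. x (k + 1) = G (v (k + 1)) (x k))"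
  proof (rule ex1_bi_infinite_orbit[OF \<open>compact Q\<close> \<open>Q \<noteq> {}\<close> _ \<open>\<mu> < 1\<close>])
    show "G (v k) x \<in> Q" if "x \<in> Q" for k x
      using positively_invariant_maps_to[OF inv vU that] .
    show "dist (G (v k) x) (G (v k) y) \<le> \<mu> * dist x y" if "x \<in> Q" "y \<in> Q" for k x y
      using contr[OF vU that] .
  qed (use \<open>0 < \<mu>\<close> in simp)
  moreover have "entire_solution G X v x \<and> (\<forall>k. x k \<in> Q) \<longleftrightarrow>
      (\<forall>k. x k \<in> Q) \<and> (\<forall>k. x (k + 1) = G (v (k + 1)) (x k))" for x
    using \<open>Q \<subseteq> X\<close> by (auto simp: entire_solution_iff_one_step)
  ultimately show "\<exists>!x. entire_solution G X v x \<and> (\<forall>k. x k \<in> Q)"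
    by simp
  fix x assume x: "entire_solution G X v x \<and> (\<forall>k. x k \<in> Q) \<and>
    (\<forall>k. x k \<in> top_of_set X interior_of Q)"
  have "positively_invariant_nonautonomous G X v (\<lambda>_. Q)"
    using inv shift_power_in_input_sequences[OF v]
    unfolding positively_invariant_nonautonomous_def positively_invariant_def by blast
  moreover have "uniformly_attracted G v (\<lambda>_. Q) x"
    by (rule uniformly_attracted_of_contraction[OF inv _ \<open>\<mu> < 1\<close> contr v])
      (use x \<open>0 < \<mu>\<close> in simp_all)
  ultimately show "UAES G X v x"
    unfolding UAES_def using x by (intro conjI exI[where x = "\<lambda>_. Q"]) auto
qed

end
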